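(* Let $F$ be a field of characteristic $\neq 2$, let $X=\{x_1,x_2,\dots\}$ be a countably infinite set, and let $\mathfrak{A}$ be the free algebra on $X$ in the variety $\mathsf{WN}^{(2)}$ of weakly Novikov metabelian algebras over $F$. Then $\mathfrak{A}$ possesses a (linear) base formed by all elements of $X$, all elements of $X^2=\{xy : x,y\in X\}$, and all base elements of $\mathfrak{A}^3$ (types (i)--(v) listed in the context), with multiplication $\cdot$ given by the following rules. (1) Every nonzero left action of a generator $x\in X$ on a base element is given by one of the following formulas, where $y,z,t,t_1,t_2\in X$: \begin{align*} x\cdot y&=xy,\\ x\cdot yz&=x(yz),\\ x\cdot y(zt)&=-(x,zy,t),\\ x\cdot (y,t_1,t_2)&=(y,xt_1,t_2). \end{align*} (2) Every nonzero right action of a generator $y\in X$ on a base element of degree $\geq 2$ is given by one of the following formulas, where $x,z,t,t_1,\dots,t_k\in X$: \begin{align*} xz\cdot y&=(x,z,y)+x(zy),\\ x(zt)\cdot y&=(x,[z,t],y)+(z,xt,y),\\ (x,t_1,t_2)\cdot y&=h(x,t_1,t_2,y)+(x,t_1\circ t_2,y),\\ h(x,t_1,t_2,t_3)\cdot y&=(xt_1)R_{t_2}R_{t_3}R_y,\\ (xt_1)R_{t_2}\cdots R_{t_k}\cdot y&=(xt_1)R_{t_2}\cdots R_{t_k}R_y,\quad k\geq 4. \end{align*} (3) All other products of base elements, not listed in the formulas above, are zero.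
   Context: Algebras are nonassociative (not necessarily associative, no unit assumed) over $F$. Notation: $(a,b,c)=(ab)c-a(bc)$ is the associator, $[a,b]=ab-ba$, $a\circ b=ab+ba$, and $R_b$ is the operator of right multiplication, written on the right: $aR_b=ab$; thus $(xt_1)R_{t_2}\cdots R_{t_k}=(\cdots((xt_1)t_2)\cdots)t_k$. The variety $\mathsf{WN}^{(2)}$ is the variety of $F$-algebras defined by the identities \begin{align*} (x,y,z)&=(x,z,y)&&\text{(right symmetry)},\\ x(y,z,t)&=(y,z,xt)&&\text{(weakly Novikov identity)},\\ (xy)(zt)&=0&&\text{(metabelian identity)}. \end{align*} Put $h(x,y,z,t)=(xy,z,t)-(y,xz,t)-2(x,yz,t)$. For an algebra $A$, $A^1=A$ and $A^n=\sum_{i+j=n}A^iA^j$. The base elements of $\mathfrak{A}^3$ are all elements of the following types, for $x,y,z,t_1,\dots,t_k\in X$: (i) $x(yz)$; (ii) $(x,t_1,t_2)$; (iii) $(x,yt_1,t_2)$; (iv) $h(x,t_1,t_2,t_3)$; (v) $(xt_1)R_{t_2}\cdots R_{t_k}$ with $k\geq 4$. Convention: in each type the letters $t_i$ indicate that the element is symmetric in all of the variables $t_i$; that is, expressions obtained from each other by a permutation of the $t_i$ denote one and the same base element. *)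

theory Defs
  imports Complex_Main "HOL-Library.Multiset"
begin

section \<open>Nonassociative algebras and the variety of weakly Novikov metabelian algebras\<close>

definition associator :: "'a \<Rightarrow> 'a \<Rightarrow> 'a \<Rightarrow> 'a::{times,minus}" where
  "associator a b c = (a * b) * c - a * (b * c)"

definition commutator :: "'a \<Rightarrow> 'a \<Rightarrow> 'a::{times,minus}" where
  "commutator a b = a * b - b * a"

definition jordan_prod :: "'a \<Rightarrow> 'a \<Rightarrow> 'a::{times,plus}" where
  "jordan_prod a b = a * b + b * a"

text \<open>
  Operators are written on the right, so \<open>right_mults a [b\<^sub>1, \<dots>, b\<^sub>k]\<close> is
  \<open>a R\<^bsub>b\<^sub>1\<^esub> \<cdots> R\<^bsub>b\<^sub>k\<^esub> = (\<cdots>((a b\<^sub>1) b\<^sub>2)\<cdots>) b\<^sub>k\<close>.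
\<close>

definition right_mults :: "'a \<Rightarrow> 'a list \<Rightarrow> 'a::times" where
  "right_mults a bs = foldl (*) a bs"

text \<open>The class \<open>times\<close> is purely syntactic: no associativity and no unit is assumed.\<close>

locale nonassoc_algebra = vector_space scale
  for scale :: "'f::field \<Rightarrow> 'a::{ab_group_add,times} \<Rightarrow> 'a" +
  assumes mult_add_left: "((a::'a) + b) * c = a * c + b * c"
    and mult_add_right: "(a::'a) * (b + c) = a * b + a * c"
    and mult_scale_left: "scale r a * b = scale r (a * b)"
    and mult_scale_right: "a * scale r b = scale r (a * b)"
begin

definition h :: "'a \<Rightarrow> 'a \<Rightarrow> 'a \<Rightarrow> 'a \<Rightarrow> 'a" where
  "h x y z t = associator (x * y) z t - associator y (x * z) t - scale 2 (associator x (y * z) t)"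

end

locale wn2_algebra = nonassoc_algebra scale
  for scale :: "'f::field \<Rightarrow> 'a::{ab_group_add,times} \<Rightarrow> 'a" +
  assumes right_symmetric: "associator (x::'a) y z = associator x z y"
    and weakly_novikov: "(x::'a) * associator y z t = associator y z (x * t)"
    and metabelian: "((x::'a) * y) * (z * t) = 0"

section \<open>The free algebra of the variety on countably many generators\<close>

text \<open>
  The free algebra is the algebra of terms in the generators \<open>x\<^sub>0, x\<^sub>1, \<dots>\<close> modulo the congruence
  generated by the axioms of \<open>wn2_algebra\<close>.
\<close>

datatype 'f aterm =
    Gen nat
  | Zero
  | Add "'f aterm" "'f aterm"
  | Neg "'f aterm"
  | Scale 'f "'f aterm"
  | Mul "'f aterm" "'f aterm"

instantiation aterm :: (type) "{zero,plus,uminus,minus,times}"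
begin

definition "0 = Zero"
definition "s + t = Add s t"
definition "- s = Neg s"
definition "s - t = Add s (Neg t)" for s t :: "'a aterm"
definition "s * t = Mul s t"

instance ..

end

inductive aterm_eq :: "'f::field aterm \<Rightarrow> 'f aterm \<Rightarrow> bool" (infix "\<approx>" 50) where
  eq_refl: "s \<approx> s"
| eq_sym: "s \<approx> t \<Longrightarrow> t \<approx> s"
| eq_trans: "s \<approx> t \<Longrightarrow> t \<approx> u \<Longrightarrow> s \<approx> u"
| cong_add: "s \<approx> s' \<Longrightarrow> t \<approx> t' \<Longrightarrow> s + t \<approx> s' + t'"
| cong_neg: "s \<approx> s' \<Longrightarrow> - s \<approx> - s'"
| cong_scale: "s \<approx> s' \<Longrightarrow> Scale r s \<approx> Scale r s'"
| cong_mult: "s \<approx> s' \<Longrightarrow> t \<approx> t' \<Longrightarrow> s * t \<approx> s' * t'"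
| add_assoc: "(s + t) + u \<approx> s + (t + u)"
| add_commute: "s + t \<approx> t + s"
| add_zero: "0 + s \<approx> s"
| add_neg: "- s + s \<approx> 0"
| scale_add_right: "Scale r (s + t) \<approx> Scale r s + Scale r t"
| scale_add_left: "Scale (r + q) s \<approx> Scale r s + Scale q s"
| scale_scale: "Scale r (Scale q s) \<approx> Scale (r * q) s"
| scale_one: "Scale 1 s \<approx> s"
| mult_add_left: "(s + t) * u \<approx> s * u + t * u"
| mult_add_right: "s * (t + u) \<approx> s * t + s * u"
| mult_scale_left: "Scale r s * t \<approx> Scale r (s * t)"
| mult_scale_right: "s * Scale r t \<approx> Scale r (s * t)"
| right_symmetric: "associator x y z \<approx> associator x z y"
| weakly_novikov: "x * associator y z t \<approx> associator y z (x * t)"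
| metabelian: "(x * y) * (z * t) \<approx> 0"

quotient_type (overloaded) 'f free_wn2 = "'f::field aterm" / aterm_eq
  by (intro equivpI reflpI sympI transpI) (blast intro: eq_refl eq_sym eq_trans)+

instantiation free_wn2 :: (field) "{ab_group_add,times}"
begin

lift_definition zero_free_wn2 :: "'a free_wn2" is 0 .

lift_definition plus_free_wn2 :: "'a free_wn2 \<Rightarrow> 'a free_wn2 \<Rightarrow> 'a free_wn2" is "(+)"
  by (rule cong_add)

lift_definition uminus_free_wn2 :: "'a free_wn2 \<Rightarrow> 'a free_wn2" is uminus
  by (rule cong_neg)

lift_definition minus_free_wn2 :: "'a free_wn2 \<Rightarrow> 'a free_wn2 \<Rightarrow> 'a free_wn2" is "(-)"
  unfolding minus_aterm_def
  by (fold plus_aterm_def uminus_aterm_def) (intro cong_add cong_neg)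

lift_definition times_free_wn2 :: "'a free_wn2 \<Rightarrow> 'a free_wn2 \<Rightarrow> 'a free_wn2" is "(*)"
  by (rule cong_mult)

instance
proof
  fix a b c :: "'a free_wn2"
  show "a + b + c = a + (b + c)" by transfer (rule aterm_eq.add_assoc)
  show "a + b = b + a" by transfer (rule aterm_eq.add_commute)
  show "0 + a = a" by transfer (rule aterm_eq.add_zero)
  show "- a + a = 0" by transfer (rule aterm_eq.add_neg)
  show "a - b = a + - b"
    by transfer (simp add: minus_aterm_def plus_aterm_def uminus_aterm_def eq_refl)
qed

end

lift_definition free_scale :: "'f::field \<Rightarrow> 'f free_wn2 \<Rightarrow> 'f free_wn2" is Scale
  by (rule cong_scale)

lift_definition gen :: "nat \<Rightarrow> 'f::field free_wn2" is Gen .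

lemma associator_transfer [transfer_rule]:
  "rel_fun (pcr_free_wn2 (=)) (rel_fun (pcr_free_wn2 (=))
     (rel_fun (pcr_free_wn2 (=)) (pcr_free_wn2 (=))))
   (associator :: 'f aterm \<Rightarrow> _) (associator :: 'f::field free_wn2 \<Rightarrow> _)"
  unfolding associator_def by transfer_prover

global_interpretation free: wn2_algebra "free_scale :: 'f::field \<Rightarrow> _"
proof
  fix r q :: 'f and a b c d :: "'f free_wn2"
  show "free_scale r (a + b) = free_scale r a + free_scale r b"
    by transfer (rule aterm_eq.scale_add_right)
  show "free_scale (r + q) a = free_scale r a + free_scale q a"
    by transfer (rule aterm_eq.scale_add_left)
  show "free_scale r (free_scale q a) = free_scale (r * q) a"
    by transfer (rule aterm_eq.scale_scale)
  show "free_scale 1 a = a" by transfer (rule aterm_eq.scale_one)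
  show "(a + b) * c = a * c + b * c" by transfer (rule aterm_eq.mult_add_left)
  show "a * (b + c) = a * b + a * c" by transfer (rule aterm_eq.mult_add_right)
  show "free_scale r a * b = free_scale r (a * b)" by transfer (rule aterm_eq.mult_scale_left)
  show "a * free_scale r b = free_scale r (a * b)" by transfer (rule aterm_eq.mult_scale_right)
  show "associator a b c = associator a c b" by transfer (rule aterm_eq.right_symmetric)
  show "a * associator b c d = associator b c (a * d)" by transfer (rule aterm_eq.weakly_novikov)
  show "(a * b) * (c * d) = 0" by transfer (rule aterm_eq.metabelian)
qed

primrec aterm_eval ::
  "('f \<Rightarrow> 'a \<Rightarrow> 'a) \<Rightarrow> (nat \<Rightarrow> 'a) \<Rightarrow> 'f aterm \<Rightarrow> 'a::{ab_group_add,times}" where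
  "aterm_eval sc f (Gen n) = f n"
| "aterm_eval sc f Zero = 0"
| "aterm_eval sc f (Add s t) = aterm_eval sc f s + aterm_eval sc f t"
| "aterm_eval sc f (Neg s) = - aterm_eval sc f s"
| "aterm_eval sc f (Scale r s) = sc r (aterm_eval sc f s)"
| "aterm_eval sc f (Mul s t) = aterm_eval sc f s * aterm_eval sc f t"

lemmas aterm_ops = zero_aterm_def plus_aterm_def uminus_aterm_def minus_aterm_def times_aterm_def

lemma aterm_eval_ops:
  "aterm_eval sc f (s + t) = aterm_eval sc f s + aterm_eval sc f t"
  "aterm_eval sc f (- s) = - aterm_eval sc f s"
  "aterm_eval sc f (s * t) = aterm_eval sc f s * aterm_eval sc f t"
  by (simp_all add: aterm_ops)

lemma aterm_eval_associator:
  "aterm_eval sc f (associator s t u)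
     = associator (aterm_eval sc f s) (aterm_eval sc f t) (aterm_eval sc f u)"
  by (simp add: associator_def aterm_ops)

lemma aterm_eval_cong:
  assumes "wn2_algebra sc" and "s \<approx> t"
  shows "aterm_eval sc f s = aterm_eval sc f t"
proof -
  interpret A: wn2_algebra sc by fact
  from assms(2) show ?thesis
  proof induction
    case (right_symmetric x y z)
    show ?case by (simp only: aterm_eval_associator A.right_symmetric)
  next
    case (weakly_novikov x y z t)
    show ?case
      by (simp only: aterm_eval_associator times_aterm_def aterm_eval.simps A.weakly_novikov)
  qed (simp_all add: aterm_ops A.scale_right_distrib A.scale_left_distrib A.mult_add_left
      A.mult_add_right A.mult_scale_left A.mult_scale_right A.metabelian)
qed

text \<open>The universal property of the free algebra of the variety.\<close>

theorem free_wn2_universal: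
  fixes sc :: "'f::field \<Rightarrow> 'a::{ab_group_add,times} \<Rightarrow> 'a" and f :: "nat \<Rightarrow> 'a"
  assumes "wn2_algebra sc"
  shows "\<exists>!\<phi>. Vector_Spaces.linear free_scale sc \<phi> \<and> (\<forall>a b. \<phi> (a * b) = \<phi> a * \<phi> b)
           \<and> (\<forall>n. \<phi> (gen n) = f n)"
proof -
  interpret A: wn2_algebra sc by fact
  define \<phi> where "\<phi> a = aterm_eval sc f (rep_free_wn2 a)" for a :: "'f free_wn2"
  have abs: "\<phi> (abs_free_wn2 s) = aterm_eval sc f s" for s
    unfolding \<phi>_def
    by (rule aterm_eval_cong[OF assms]) (metis Quotient3_free_wn2 rep_abs_rsp_left aterm_eq.eq_refl)
  have plus: "\<phi> (a + b) = \<phi> a + \<phi> b" for a b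
    by (induction a; induction b) (simp add: plus_free_wn2.abs_eq abs plus_aterm_def)
  have scale: "\<phi> (free_scale r a) = sc r (\<phi> a)" for r a
    by (induction a) (simp add: free_scale.abs_eq abs)
  have mult: "\<phi> (a * b) = \<phi> a * \<phi> b" for a b
    by (induction a; induction b) (simp add: times_free_wn2.abs_eq abs times_aterm_def)
  have gen: "\<phi> (gen n) = f n" for n
    by (simp add: gen.abs_eq abs)
  have lin: "Vector_Spaces.linear free_scale sc \<phi>"
    by unfold_locales (simp_all add: plus scale)
  show ?thesis
  proof (rule ex1I[of _ \<phi>])
    fix \<psi>
    assume \<psi>: "Vector_Spaces.linear free_scale sc \<psi> \<and> (\<forall>a b. \<psi> (a * b) = \<psi> a * \<psi> b)
      \<and> (\<forall>n. \<psi> (gen n) = f n)"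
    then interpret L: Vector_Spaces.linear free_scale sc \<psi> by blast
    have "\<psi> (abs_free_wn2 s) = aterm_eval sc f s" for s
    proof (induction s)
      case (Gen n)
      then show ?case using \<psi> by (simp flip: gen.abs_eq)
    next
      case Zero
      then show ?case using L.zero by (simp add: zero_free_wn2_def zero_aterm_def)
    next
      case (Add s t)
      then show ?case using L.add by (simp add: aterm_eval_ops flip: plus_free_wn2.abs_eq plus_aterm_def)
    next
      case (Neg s)
      then show ?case using L.neg by (simp add: aterm_eval_ops flip: uminus_free_wn2.abs_eq uminus_aterm_def)
    next
      case (Scale r s)
      then show ?case using L.scale by (simp flip: free_scale.abs_eq)
    next
      case (Mul s t)
      then show ?case using \<psi> by (simp add: aterm_eval_ops flip: times_free_wn2.abs_eq times_aterm_def)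
    qed
    then have "\<psi> a = \<phi> a" for a by (induction a) (simp add: abs)
    then show "\<psi> = \<phi>" by blast
  qed (use lin mult gen in blast)
qed

section \<open>Base elements\<close>

text \<open>
  Base elements are named by symbols; \<open>same_base\<close> identifies the symbols that differ
  only by a permutation of the letters \<open>t\<^sub>i\<close>.
\<close>

datatype base_sym =
    Letter nat
  | Word2 nat nat
  | Base_i nat nat nat
  | Base_ii nat nat nat
  | Base_iii nat nat nat nat
  | Base_iv nat nat nat nat
  | Base_v nat "nat list"

definition base_syms :: "base_sym set" where
  "base_syms = {b. \<forall>x ts. b = Base_v x ts \<longrightarrow> length ts \<ge> 4}"

fun base_value :: "base_sym \<Rightarrow> 'f::field free_wn2" where
  "base_value (Letter x) = gen x"
| "base_value (Word2 x y) = gen x * gen y"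
| "base_value (Base_i x y z) = gen x * (gen y * gen z)"
| "base_value (Base_ii x t1 t2) = associator (gen x) (gen t1) (gen t2)"
| "base_value (Base_iii x y t1 t2) = associator (gen x) (gen y * gen t1) (gen t2)"
| "base_value (Base_iv x t1 t2 t3) = free.h (gen x) (gen t1) (gen t2) (gen t3)"
| "base_value (Base_v x ts) = right_mults (gen x) (map gen ts)"

inductive same_base :: "base_sym \<Rightarrow> base_sym \<Rightarrow> bool" where
  "same_base (Letter x) (Letter x)"
| "same_base (Word2 x y) (Word2 x y)"
| "same_base (Base_i x y z) (Base_i x y z)"
| "{#t1, t2#} = {#s1, s2#} \<Longrightarrow> same_base (Base_ii x t1 t2) (Base_ii x s1 s2)"
| "{#t1, t2#} = {#s1, s2#} \<Longrightarrow> same_base (Base_iii x y t1 t2) (Base_iii x y s1 s2)"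
| "{#t1, t2, t3#} = {#s1, s2, s3#} \<Longrightarrow> same_base (Base_iv x t1 t2 t3) (Base_iv x s1 s2 s3)"
| "mset ts = mset ss \<Longrightarrow> same_base (Base_v x ts) (Base_v x ss)"

text \<open>The pairs of base elements whose product has an explicit formula in the multiplication rules.\<close>

inductive listed_product :: "base_sym \<Rightarrow> base_sym \<Rightarrow> bool" where
  "listed_product (Letter x) (Letter y)"
| "listed_product (Letter x) (Word2 y z)"
| "listed_product (Letter x) (Base_i y z t)"
| "listed_product (Letter x) (Base_ii y t1 t2)"
| "listed_product (Word2 x z) (Letter y)"
| "listed_product (Base_i x z t) (Letter y)"
| "listed_product (Base_ii x t1 t2) (Letter y)"
| "listed_product (Base_iv x t1 t2 t3) (Letter y)"
| "listed_product (Base_v x ts) (Letter y)"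

end

theory Submission
  imports Defs "HOL-Library.Poly_Mapping"
begin

text \<open>
  The multiplication rules, including the vanishing of the products that are not listed, are
  identities of the variety: they hold for arbitrary elements of any algebra of the variety, and so
  do the symmetries in the letters \<open>t\<^sub>i\<close>. The starting point is
  \<open>(x, yz, t) = y (x, z, t)\<close>, which combines right symmetry with the weakly Novikov
  identity (\<open>associator_mult_middle\<close>). Expressing \<open>h(x, s, t, y)\<close> as
  \<open>(x, s, t) y - (x, s \<circ> t, y)\<close> (\<open>associator_mult\<close>) makes \<open>h\<close>
  symmetric in its last three arguments, and this symmetry together with the metabelian identity
  shows that the elements \<open>(x, yz, t)\<close> annihilate the algebra from both sides
  (\<open>mult_associator_product\<close>, \<open>associator_product_mult\<close>). On products, right
  multiplications commute, which gives the symmetry of the long words (\<open>right_mults_perm\<close>).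
  It follows that the span of the base elements is closed under multiplication, hence is the whole
  free algebra (\<open>span_base_values\<close>).

  For linear independence, the rules are read as a multiplication table on a vector space whose basis
  is indexed by normal forms of the base elements. Since the identities are multilinear, it is enough
  to check them on basis vectors, and a case distinction shows that this algebra belongs to the variety
  (\<open>wn2_model\<close>). The homomorphism from the free algebra that sends generators to the
  corresponding basis vectors maps every base element to the basis vector of its normal form
  (\<open>to_model_base_value\<close>), so base elements with different normal forms are linearly
  independent.
\<close>

section \<open>Multilinearity\<close>

context nonassoc_algebra
begin

lemma mult_zero_left [simp]: "0 * a = (0::'a)"
  by (metis add_cancel_right_left mult_add_left)

lemma mult_zero_right [simp]: "a * 0 = (0::'a)"
  by (metis add_cancel_right_left mult_add_right)

lemma mult_minus_left [simp]: "(- a) * b = - (a * b :: 'a)"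
  by (metis eq_neg_iff_add_eq_0 mult_add_left mult_zero_left)

lemma mult_minus_right [simp]: "a * (- b) = - (a * b :: 'a)"
  by (metis eq_neg_iff_add_eq_0 mult_add_right mult_zero_right)

lemma mult_diff_left: "(a - b) * c = a * c - b * (c::'a)"
  by (metis mult_add_left mult_minus_left add_uminus_conv_diff)

lemma mult_diff_right: "a * (b - c) = a * b - a * (c::'a)"
  by (metis mult_add_right mult_minus_right add_uminus_conv_diff)

lemmas mult_linear =
  mult_add_left mult_add_right mult_diff_left mult_diff_right mult_scale_left mult_scale_right

lemma mult_sum_mset_left: "(\<Sum>t\<in>#M. f t) * a = (\<Sum>t\<in>#M. f t * (a::'a))"
  by (induction M) (simp_all add: mult_add_left)

lemma mult_sum_mset_right: "a * (\<Sum>t\<in>#M. f t) = (\<Sum>t\<in>#M. a * (f t::'a))"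
  by (induction M) (simp_all add: mult_add_right)

lemma associator_zero [simp]:
  "associator 0 b c = (0::'a)" "associator a 0 c = (0::'a)" "associator a b 0 = (0::'a)"
  by (simp_all add: associator_def)

lemma associator_add:
  "associator (a + a') b c = associator a b c + (associator a' b c :: 'a)"
  "associator a (b + b') c = associator a b c + (associator a b' c :: 'a)"
  "associator a b (c + c') = associator a b c + (associator a b c' :: 'a)"
  by (simp_all add: associator_def mult_linear)

lemma associator_diff:
  "associator a (b - b') c = associator a b c - (associator a b' c :: 'a)"
  by (simp_all add: associator_def mult_linear)

lemma associator_scale:
  "associator (scale r a) b c = scale r (associator a b c)"
  "associator a (scale r b) c = scale r (associator a b c)"
  "associator a b (scale r c) = scale r (associator a b c)"
  by (simp_all add: associator_def mult_linear scale_right_diff_distrib)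

lemma span_induct_linear [consumes 1, case_names base zero add scale]:
  assumes "a \<in> span S" and "\<And>a. a \<in> S \<Longrightarrow> P a" and "P 0"
    and "\<And>a b. P a \<Longrightarrow> P b \<Longrightarrow> P (a + b)" and "\<And>r a. P a \<Longrightarrow> P (scale r a)"
  shows "P a"
  using assms(1)
  by (rule span_induct) (auto simp: subspace_def intro: assms(2-))

text \<open>
  The defining identities are multilinear, so they only have to be verified on a spanning set.
\<close>

lemma wn2_algebra_if_spanning:
  assumes S: "span S = UNIV"
    and rs: "\<And>a b c. a \<in> S \<Longrightarrow> b \<in> S \<Longrightarrow> c \<in> S \<Longrightarrow> associator a b c = associator a c b"
    and wn: "\<And>a b c d. a \<in> S \<Longrightarrow> b \<in> S \<Longrightarrow> c \<in> S \<Longrightarrow> d \<in> S \<Longrightarrow>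
               a * associator b c d = associator b c (a * d)"
    and mb: "\<And>a b c d. a \<in> S \<Longrightarrow> b \<in> S \<Longrightarrow> c \<in> S \<Longrightarrow> d \<in> S \<Longrightarrow> (a * b) * (c * d) = 0"
  shows "wn2_algebra scale"
proof unfold_locales
  have all: "a \<in> span S" for a
    by (simp add: S)
  fix a b c d :: 'a
  note linear = associator_add associator_scale mult_linear
  show "associator a b c = associator a c b"
    using all[of a]
  proof (induction rule: span_induct_linear)
    case (base a)
    show ?case
      using all[of b]
    proof (induction rule: span_induct_linear)
      case (base b)
      show ?case
        using all[of c] by (induction rule: span_induct_linear) (simp_all add: linear rs \<open>a \<in> S\<close> base)
    qed (simp_all add: linear)
  qed (simp_all add: linear)
  show "a * associator b c d = associator b c (a * d)"
    using all[of a]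
  proof (induction rule: span_induct_linear)
    case (base a)
    show ?case
      using all[of b]
    proof (induction rule: span_induct_linear)
      case (base b)
      show ?case
        using all[of c]
      proof (induction rule: span_induct_linear)
        case (base c)
        show ?case
          using all[of d]
          by (induction rule: span_induct_linear) (simp_all add: linear wn \<open>a \<in> S\<close> \<open>b \<in> S\<close> base)
      qed (simp_all add: linear)
    qed (simp_all add: linear)
  qed (simp_all add: linear)
  show "(a * b) * (c * d) = 0"
    using all[of a]
  proof (induction rule: span_induct_linear)
    case (base a)
    show ?case
      using all[of b]
    proof (induction rule: span_induct_linear)
      case (base b)
      show ?case
        using all[of c]
      proof (induction rule: span_induct_linear)
        case (base c)
        show ?case
          using all[of d]
          by (induction rule: span_induct_linear) (simp_all add: linear mb \<open>a \<in> S\<close> \<open>b \<in> S\<close> base)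
      qed (simp_all add: linear)
    qed (simp_all add: linear)
  qed (simp_all add: linear)
qed

end

section \<open>Identities\<close>

context wn2_algebra
begin

text \<open>
  The square \<open>A\<^sup>2\<close> of the algebra, that is, the linear span of all products. The
  metabelian identity says that \<open>A\<^sup>2A\<^sup>2 = 0\<close>.
\<close>

definition square :: "'a set" where
  "square = span {a * b |a b. True}"

lemma mult_in_square [simp]: "a * b \<in> square"
  unfolding square_def by (rule span_base) blast

lemma square_mult_square:
  assumes "u \<in> square" and "v \<in> square"
  shows "u * v = 0"
  using assms(1) unfolding square_def
proof (induction rule: span_induct_linear)
  case (base u)
  show ?case
    using assms(2) unfolding square_def
    by (induction rule: span_induct_linear) (use base in \<open>auto simp: mult_linear metabelian\<close>)
qed (simp_all add: mult_linear)

lemma associator_in_square [simp]: "associator a b c \<in> square"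
  using mult_in_square unfolding associator_def square_def by (blast intro: span_diff)

lemma h_in_square [simp]: "h x y z t \<in> square"
  using associator_in_square unfolding h_def square_def by (blast intro: span_diff span_scale)

lemma right_mults_in_square:
  assumes "ts \<noteq> []"
  shows "right_mults (x::'a) ts \<in> square"
  using assms by (cases ts rule: rev_cases) (simp_all add: right_mults_def)

lemma associator_mult_middle: "associator x (y * z) t = y * associator x z (t::'a)"
  by (metis right_symmetric weakly_novikov)

lemma associator_middle_swap: "associator x (y * z) t = associator x (y * t) (z::'a)"
  by (metis right_symmetric weakly_novikov)

lemma left_mult_left_product: "x * (y * (z * t)) = - associator x (z * y) (t::'a)"
proof -
  have "associator x y (z * t) = - (x * (y * (z * t)))"
    by (simp add: associator_def metabelian)
  then show ?thesis
    by (metis associator_middle_swap right_symmetric add.inverse_inverse)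
qed

lemma left_product_mult:
  "(x * (z * t)) * y = associator x (commutator z t) y + associator z (x * t) (y::'a)"
proof -
  have "(x * (z * t)) * y = associator x (z * t) y + x * ((z * t) * y)"
    by (simp add: associator_def)
  also have "(z * t) * y = associator z t y + z * (t * y)"
    by (simp add: associator_def)
  finally show ?thesis
    by (simp add: mult_add_right left_mult_left_product commutator_def associator_diff
        flip: associator_mult_middle)
qed

lemma associator_mult:
  "associator x s t * y = h x s t y + associator x (jordan_prod s t) y"
proof -
  have "associator (x * s) t y = associator x s t * y + (x * (s * t)) * y"
    by (simp add: associator_def mult_linear metabelian)
  moreover have "scale 2 v = v + v" for v
    using scale_left_distrib[of 1 1 v] by simp
  ultimately show ?thesis
    unfolding h_def
    by (simp add: left_product_mult commutator_def jordan_prod_def associator_add associator_diff)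
qed

lemma h_swap_right: "h x y z t = h x y t z"
  unfolding h_def
  by (metis associator_middle_swap right_symmetric)

text \<open>
  By \<open>associator_mult\<close>, \<open>h(x, y, z, t) = (x, y, z) t - (x, y \<circ> z, t)\<close>, which is
  symmetric in \<open>y\<close> and \<open>z\<close>. With \<open>h_swap_right\<close>, \<open>h\<close> is symmetric
  in its last three arguments.
\<close>

lemma h_swap_left: "h x y z t = h x z y t"
proof -
  have "h x s r t = associator x s r * t - associator x (jordan_prod s r) t" for s r
    by (simp add: associator_mult)
  then show ?thesis
    by (simp add: jordan_prod_def right_symmetric[of x y z] add.commute)
qed

lemma associator_square_mult: "u \<in> square \<Longrightarrow> associator u b (c * d) = 0"
  by (simp add: associator_def square_mult_square)

lemma associator_product_product: "associator a (b * b') (c * d) = (0::'a)"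
  by (simp add: associator_def metabelian)

lemma mult_associator_product: "w * associator x (y * z) t = (0::'a)"
  by (simp add: weakly_novikov associator_product_product)

text \<open>
  By \<open>associator_mult\<close>, the product is
  \<open>h(x, yz, t, w) + (x, (yz) \<circ> t, w)\<close>. Both terms vanish; in the first one the factor
  \<open>yz\<close> is moved to the last position by the symmetry of \<open>h\<close>.
\<close>

lemma associator_product_mult: "associator x (y * z) t * w = (0::'a)"
proof -
  have "h x (y * z) t w = h x t w (y * z)"
    by (metis h_swap_left h_swap_right)
  also have "\<dots> = 0"
    by (simp add: h_def associator_square_mult associator_product_product)
  finally show ?thesis
    by (simp add: associator_mult jordan_prod_def associator_add associator_mult_middle[of x t]
        associator_mult_middle[of x "y * z"] mult_associator_product square_mult_square)
qed

lemma mult_h: "w * h x y z t = 0"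
  unfolding h_def
  by (simp add: mult_linear mult_associator_product)
    (simp add: weakly_novikov associator_square_mult)

lemma h_mult: "h x s t u * y = right_mults (x * s) [t, u, y]"
proof -
  have "h x s t u * y = associator (x * s) t u * y"
    by (simp add: h_def mult_linear associator_product_mult)
  then show ?thesis
    by (simp add: right_mults_def associator_def metabelian)
qed

lemma square_mult_mult:
  assumes "u \<in> square"
  shows "(u * a) * b = associator u a b"
  using assms by (simp add: associator_def square_mult_square)

lemma mult_right_mults:
  assumes "length ts \<ge> 4"
  shows "w * right_mults x ts = (0::'a)"
proof -
  \<comment> \<open>Since \<open>u = x R\<^bsub>s\<^esub>\<close> is a product, \<open>(u c) d = (u, c, d)\<close>, and a left
    factor \<open>w\<close> moves into the last argument.\<close>
  obtain s c d where ts: "ts = s @ [c, d]" and "s \<noteq> []"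
  proof -
    have "length (drop (length ts - 2) ts) = Suc (Suc 0)"
      using assms by simp
    then obtain c d where "drop (length ts - 2) ts = [c, d]"
      unfolding length_Suc_conv by auto
    then have "ts = take (length ts - 2) ts @ [c, d]"
      by (metis append_take_drop_id)
    moreover have "take (length ts - 2) ts \<noteq> []"
      using assms by auto
    ultimately show thesis
      by (rule that)
  qed
  let ?u = "right_mults x s"
  have u: "?u \<in> square"
    using \<open>s \<noteq> []\<close> by (rule right_mults_in_square)
  have "right_mults x ts = (?u * c) * d"
    by (simp add: ts right_mults_def)
  then show ?thesis
    by (simp add: u square_mult_mult weakly_novikov associator_square_mult)
qed

text \<open>
  On \<open>A\<^sup>2\<close> the operators of right multiplication commute, because there
  \<open>(u a) b = (u, a, b)\<close>.
\<close>

lemma right_mults_move_front: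
  assumes "u \<in> square"
  shows "right_mults u (p @ a # q) = right_mults u (a # p @ q)"
  using assms
proof (induction p arbitrary: u)
  case (Cons b p)
  then have "(u * b) * a = (u * a) * b"
    by (simp add: square_mult_mult right_symmetric[of u a b])
  with Cons.IH[of "u * b"] show ?case
    by (simp add: right_mults_def)
qed simp

lemma right_mults_square_perm:
  assumes "u \<in> square" and "mset ts = mset ss"
  shows "right_mults u ts = right_mults u ss"
  using assms
proof (induction ts arbitrary: u ss)
  case (Cons a ts)
  then have "a \<in> set ss"
    by (metis list.set_intros(1) mset_eq_setD)
  then obtain p q where ss: "ss = p @ a # q"
    by (meson split_list)
  with Cons.prems have "mset ts = mset (p @ q)"
    by simp
  with Cons.IH[of "u * a"] have "right_mults (u * a) ts = right_mults (u * a) (p @ q)"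
    by simp
  with right_mults_move_front[OF Cons.prems(1)] show ?case
    by (simp add: ss right_mults_def)
qed simp

text \<open>
  The first two letters of a long word lie below \<open>A\<^sup>2\<close>; their interchange rests on the
  symmetry of \<open>h\<close> and on \<open>(((x a) b) c) d = h(x, a, b, c) d\<close>.
\<close>

lemma right_mults_swap_first:
  assumes "length ts \<ge> 2"
  shows "right_mults x (a # b # ts) = right_mults (x::'a) (b # a # ts)"
proof -
  obtain c d r where ts: "ts = c # d # r"
    using assms by (cases ts; cases "tl ts") auto
  have "(((x * a) * b) * c) * d = (((x * b) * a) * c) * d"
    using h_mult[of x a b c d] h_mult[of x b a c d] h_swap_left[of x a b c]
    by (simp add: right_mults_def)
  then show ?thesis
    by (simp add: ts right_mults_def)
qed

lemma right_mults_perm: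
  assumes "length ts \<ge> 4" and "mset ts = mset ss"
  shows "right_mults (x::'a) ts = right_mults x ss"
proof -
  obtain a ts' where ts: "ts = a # ts'"
    using assms(1) by (cases ts) auto
  obtain b ss' where ss: "ss = b # ss'"
    using assms by (cases ss) auto
  have tail: "right_mults x (c # xs) = right_mults x (c # ys)" if "mset xs = mset ys" for c xs ys
    using right_mults_square_perm[of "x * c", OF _ that] by (simp add: right_mults_def)
  show ?thesis
  proof (cases "a = b")
    case True
    with assms(2) tail[of ts' ss' a] show ?thesis
      by (simp add: ts ss)
  next
    case False
    then have "b \<in> set ts'"
      using assms(2) ts ss by (metis list.set_intros(1) mset_eq_setD set_ConsD)
    then obtain p q where "ts' = p @ b # q"
      by (meson split_list)
    then have pq: "mset ts' = mset (b # p @ q)"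
      by simp
    have len: "length (p @ q) \<ge> 2"
      using assms(1) ts \<open>ts' = p @ b # q\<close> by simp
    have "right_mults x ts = right_mults x (a # b # p @ q)"
      unfolding ts using pq by (rule tail)
    also have "\<dots> = right_mults x (b # a # p @ q)"
      using len by (rule right_mults_swap_first)
    also have "\<dots> = right_mults x ss"
      unfolding ss using assms(2) pq ts ss by (intro tail) (simp add: add_mset_commute)
    finally show ?thesis .
  qed
qed

end

section \<open>An algebra with a prescribed multiplication table\<close>

text \<open>
  Normal forms of base elements, in the order letters, \<open>xy\<close>, \<open>x(yz)\<close>,
  \<open>(x, t\<^sub>1, t\<^sub>2)\<close>, \<open>(x, y t\<^sub>1, t\<^sub>2)\<close>. The letters in which an
  element is symmetric are collected in a multiset. The elements \<open>h(x, t\<^sub>1, t\<^sub>2, t\<^sub>3)\<close>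
  and the long words share the constructor \<open>NPow\<close>, because right multiplication acts on both by
  adding a letter to the multiset; the size of the multiset tells them apart. Multisets of any size are
  admitted: the surplus symbols do no harm, since the identities hold for them as well.
\<close>

datatype normal_sym =
    NLetter nat
  | NWord nat nat
  | NLeft nat nat nat
  | NAss nat "nat multiset"
  | NAss_Mul nat nat "nat multiset"
  | NPow nat "nat multiset"

text \<open>
  The vector space with basis \<open>normal_sym\<close>. It is a type of its own because the multiplication
  needed here is not the convolution product of finitely supported functions.
\<close>

context
  notes [[typedef_overloaded]]
begin

datatype 'f model = Model (coeffs: "normal_sym \<Rightarrow>\<^sub>0 'f::field")

end

instantiation model :: (field) ab_group_add
begin

definition "0 = Model 0"
definition "a + b = Model (coeffs a + coeffs b)" for a b :: "'a model"
definition "a - b = Model (coeffs a - coeffs b)" for a b :: "'a model"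
definition "- a = Model (- coeffs a)" for a :: "'a model"

instance
  by standard (simp_all add: zero_model_def plus_model_def minus_model_def uminus_model_def
      model.expand algebra_simps)

end

definition model_scale :: "'f::field \<Rightarrow> 'f model \<Rightarrow> 'f model" where
  "model_scale r a = Model (Poly_Mapping.map ((*) r) (coeffs a))"

text \<open>
  The coordinate of a vector at the basis vector \<open>s\<close>; the basis vectors themselves are
  \<open>unit_vec s\<close>, defined below.
\<close>

definition coord :: "normal_sym \<Rightarrow> 'f::field model \<Rightarrow> 'f" where
  "coord s a = Poly_Mapping.lookup (coeffs a) s"

lemma coord_linear [simp]:
  "coord s 0 = 0"
  "coord s (a + b) = coord s a + coord s b"
  "coord s (model_scale r a) = r * coord s a"
  by (simp_all add: zero_model_def plus_model_def model_scale_def coord_def lookup_add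
      Poly_Mapping.map.rep_eq when_def)

lemma model_eqI:
  assumes "\<And>s. coord s a = coord s b"
  shows "a = b"
  using assms unfolding coord_def by (intro model.expand poly_mapping_eqI)

interpretation model: vector_space model_scale
  by unfold_locales (auto intro!: model_eqI simp: algebra_simps)

definition unit_vec :: "normal_sym \<Rightarrow> 'f::field model" where
  "unit_vec s = Model (Poly_Mapping.single s 1)"

lemma coord_unit_vec: "coord r (unit_vec s) = (1 when s = r)"
  by (simp add: coord_def unit_vec_def lookup_single)

text \<open>
  The linear extension to the whole space of a map \<open>T\<close> on basis vectors.
\<close>

definition linear_ext :: "(normal_sym \<Rightarrow> 'f model) \<Rightarrow> 'f model \<Rightarrow> 'f::field model" where
  "linear_ext T a = (\<Sum>s\<in>Poly_Mapping.keys (coeffs a). model_scale (coord s a) (T s))"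

lemma linear_ext_superset:
  assumes "finite K" and "Poly_Mapping.keys (coeffs a) \<subseteq> K"
  shows "linear_ext T a = (\<Sum>s\<in>K. model_scale (coord s a) (T s))"
  unfolding linear_ext_def
  using assms by (intro sum.mono_neutral_left) (auto simp: coord_def in_keys_iff)

lemma linear_ext_add: "linear_ext T (a + b) = linear_ext T a + linear_ext T b"
proof -
  let ?K = "Poly_Mapping.keys (coeffs a) \<union> Poly_Mapping.keys (coeffs b)"
  have "Poly_Mapping.keys (coeffs (a + b)) \<subseteq> ?K"
    by (simp add: plus_model_def keys_add)
  then show ?thesis
    by (simp add: linear_ext_superset[of ?K] model.scale_left_distrib sum.distrib)
qed

lemma linear_ext_scale: "linear_ext T (model_scale r a) = model_scale r (linear_ext T a)"
proof -
  have "Poly_Mapping.keys (coeffs (model_scale r a)) \<subseteq> Poly_Mapping.keys (coeffs a)"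
    using coord_linear(3)[of _ r a] by (auto simp: coord_def in_keys_iff)
  then show ?thesis
    by (simp add: linear_ext_superset[of "Poly_Mapping.keys (coeffs a)"] model.scale_sum_right)
qed

lemma linear_ext_unit_vec [simp]: "linear_ext T (unit_vec s) = T s"
  by (simp add: linear_ext_def coord_def unit_vec_def)

lemma linear_ext_fun_add: "linear_ext (\<lambda>s. T s + U s) a = linear_ext T a + linear_ext U a"
  by (simp add: linear_ext_def model.scale_right_distrib sum.distrib)

lemma linear_ext_fun_scale: "linear_ext (\<lambda>s. model_scale r (T s)) a = model_scale r (linear_ext T a)"
  by (simp add: linear_ext_def model.scale_sum_right mult.commute)

lemma linear_ext_eq_self: "linear_ext unit_vec a = a"
proof (rule model_eqI)
  fix r
  have sum: "coord r (sum g K) = (\<Sum>s\<in>K. coord r (g s))"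
    for g :: "normal_sym \<Rightarrow> 'a model" and K
    by (induction K rule: infinite_finite_induct) simp_all
  have "coord r a = 0" if "r \<notin> Poly_Mapping.keys (coeffs a)"
    using that by (simp add: coord_def in_keys_iff)
  then show "coord r (linear_ext unit_vec a) = coord r a"
    by (auto simp: linear_ext_def sum coord_unit_vec when_def if_distrib cong: if_cong)
qed

text \<open>
  The multiplication rules. The sum over the multiset \<open>M = {t\<^sub>1, t\<^sub>2}\<close> is
  \<open>(x, t\<^sub>1 \<circ> t\<^sub>2, y)\<close>; written in this way it makes sense for every \<open>M\<close>.
\<close>

fun table :: "normal_sym \<Rightarrow> normal_sym \<Rightarrow> 'f::field model" where
  "table (NLetter x) (NLetter y) = unit_vec (NWord x y)"
| "table (NLetter x) (NWord y z) = unit_vec (NLeft x y z)"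
| "table (NLetter x) (NLeft y z t) = - unit_vec (NAss_Mul x z {#y, t#})"
| "table (NLetter x) (NAss y M) = unit_vec (NAss_Mul y x M)"
| "table (NWord x z) (NLetter y) = unit_vec (NAss x {#z, y#}) + unit_vec (NLeft x z y)"
| "table (NLeft x z t) (NLetter y) = unit_vec (NAss_Mul x z {#t, y#})
     - unit_vec (NAss_Mul x t {#z, y#}) + unit_vec (NAss_Mul z x {#t, y#})"
| "table (NAss x M) (NLetter y) = unit_vec (NPow x (add_mset y M))
     + (\<Sum>t\<in>#M. unit_vec (NAss_Mul x t (add_mset y (M - {#t#}))))"
| "table (NPow x M) (NLetter y) = unit_vec (NPow x (add_mset y M))"
| "table _ _ = 0"

text \<open>
  The multiplication of the algebra: the bilinear extension of the table.
\<close>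

instantiation model :: (field) times
begin

definition "a * b = linear_ext (\<lambda>s. linear_ext (table s) b) a" for a b :: "'a model"

instance ..

end

interpretation model: nonassoc_algebra model_scale
  by unfold_locales
    (simp_all add: times_model_def linear_ext_add linear_ext_scale linear_ext_fun_add
      linear_ext_fun_scale)

lemma unit_vec_mult: "unit_vec s * unit_vec r = table s r"
  by (simp add: times_model_def)

lemma span_unit_vec: "model.span (range unit_vec) = UNIV"
proof -
  have "linear_ext unit_vec a \<in> model.span (range unit_vec)" for a :: "'a model"
    unfolding linear_ext_def
    by (intro model.span_sum model.span_scale model.span_base) simp
  then show ?thesis
    by (auto simp: linear_ext_eq_self)
qed

lemma NAss_Mul_annihilates:
  "unit_vec (NAss_Mul x y M) * v = 0" "v * unit_vec (NAss_Mul x y M) = 0"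
proof -
  have v: "v \<in> model.span (range unit_vec)"
    by (simp add: span_unit_vec)
  have "table (NAss_Mul x y M) s = 0" "table s (NAss_Mul x y M) = 0" for s
    by (cases s; simp)+
  with v show "unit_vec (NAss_Mul x y M) * v = 0" "v * unit_vec (NAss_Mul x y M) = 0"
    by (induction rule: model.span_induct_linear) (auto simp: unit_vec_mult model.mult_linear)
qed

lemma sum_NAss_Mul_annihilates:
  "(\<Sum>t\<in>#N. unit_vec (NAss_Mul x t (f t))) * v = 0"
  "v * (\<Sum>t\<in>#N. unit_vec (NAss_Mul x t (f t))) = 0"
  by (simp_all add: model.mult_sum_mset_left model.mult_sum_mset_right NAss_Mul_annihilates)

text \<open>
  The decisive cases are those of total degree three and four, and the associators
  \<open>(a, b, c)\<close> with \<open>b\<close> and \<open>c\<close> letters, where both sides of right symmetry are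
  obtained by adding \<open>b\<close> and \<open>c\<close> to a multiset. In all other cases both sides vanish.
\<close>

lemma wn2_model: "wn2_algebra (model_scale :: 'f::field \<Rightarrow> _)"
proof (rule model.wn2_algebra_if_spanning[OF span_unit_vec], goal_cases)
  case (1 a b c)
  then obtain s r q where [simp]: "a = unit_vec s" "b = unit_vec r" "c = unit_vec q"
    by auto
  show ?case
    by (cases s; cases r; cases q)
      (simp_all add: associator_def unit_vec_mult model.mult_linear
        sum_NAss_Mul_annihilates add_mset_commute)
next
  case (2 a b c d)
  then obtain s r q p where [simp]: "a = unit_vec s" "b = unit_vec r" "c = unit_vec q" "d = unit_vec p"
    by auto
  show ?case
    by (cases s; cases r; cases q; cases p)
      (simp_all add: associator_def unit_vec_mult model.mult_linear
        sum_NAss_Mul_annihilates add_mset_commute)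
next
  case (3 a b c d)
  then obtain s r q p where [simp]: "a = unit_vec s" "b = unit_vec r" "c = unit_vec q" "d = unit_vec p"
    by auto
  show ?case
    by (cases s; cases r; cases q; cases p)
      (simp_all add: unit_vec_mult model.mult_linear sum_NAss_Mul_annihilates)
qed

section \<open>The base of the free algebra\<close>

text \<open>
  The normal form of a base symbol forgets the order of the letters \<open>t\<^sub>i\<close>: on
  \<open>base_syms\<close>, two symbols have the same normal form exactly if \<open>same_base\<close> relates
  them.
\<close>

fun normal :: "base_sym \<Rightarrow> normal_sym" where
  "normal (Letter x) = NLetter x"
| "normal (Word2 x y) = NWord x y"
| "normal (Base_i x y z) = NLeft x y z"
| "normal (Base_ii x s t) = NAss x {#s, t#}"
| "normal (Base_iii x y s t) = NAss_Mul x y {#s, t#}"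
| "normal (Base_iv x s t u) = NPow x {#s, t, u#}"
| "normal (Base_v x ts) = NPow x (mset ts)"

lemma same_base_if_normal_eq:
  assumes "b \<in> base_syms" and "c \<in> base_syms" and "normal b = normal c"
  shows "same_base b c"
proof -
  \<comment> \<open>The length condition in \<open>base_syms\<close> separates long words from \<open>h(x, s, t, u)\<close>.\<close>
  have "mset ts \<noteq> {#s, t, u#}" if "length ts \<ge> 4" for ts :: "nat list" and s t u
    using that by (auto dest: arg_cong[where f = size])
  then show ?thesis
    using assms
    by (cases b; cases c) (auto simp: base_syms_def intro: same_base.intros dest: sym)
qed

lemma base_value_eq_if_same_base:
  assumes "same_base b c" and "b \<in> base_syms"
  shows "base_value b = base_value c"
  using assms
proof cases
  case (4 t1 t2 s1 s2 x)
  then show ?thesis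
    by (auto simp: add_eq_conv_ex free.right_symmetric)
next
  case (5 t1 t2 s1 s2 x y)
  then show ?thesis
    by (auto simp: add_eq_conv_ex free.associator_middle_swap)
next
  case (6 t1 t2 t3 s1 s2 s3 x)
  then show ?thesis
    by (auto simp: add_eq_conv_ex) (metis free.h_swap_left free.h_swap_right)+
next
  case (7 ts ss x)
  then show ?thesis
    using assms(2) by (auto simp: base_syms_def intro!: free.right_mults_perm)
qed simp_all

text \<open>
  The homomorphism from the free algebra that is given by its universal property.
\<close>

definition to_model :: "'f::field free_wn2 \<Rightarrow> 'f model" where
  "to_model = (SOME \<phi>. Vector_Spaces.linear free_scale model_scale \<phi>
     \<and> (\<forall>a b. \<phi> (a * b) = \<phi> a * \<phi> b) \<and> (\<forall>n. \<phi> (gen n) = unit_vec (NLetter n)))"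

lemma to_model:
  "Vector_Spaces.linear free_scale model_scale to_model"
  "to_model (a * b) = to_model a * to_model b"
  "to_model (gen n) = unit_vec (NLetter n)"
  using someI_ex[OF ex1_implies_ex[OF free_wn2_universal[OF wn2_model,
    of "\<lambda>n. unit_vec (NLetter n)"]], folded to_model_def] by blast+

interpretation to_model: Vector_Spaces.linear free_scale model_scale to_model
  by (rule to_model)

lemma model_scale_2: "model_scale 2 v = v + v"
  using model.scale_left_distrib[of 1 1 v] by simp

lemma to_model_associator:
  "to_model (associator a b c) = associator (to_model a) (to_model b) (to_model c)"
  by (simp add: associator_def to_model to_model.diff)

lemma to_model_h:
  "to_model (free.h x y z t) = model.h (to_model x) (to_model y) (to_model z) (to_model t)"
  by (simp add: free.h_def model.h_def to_model to_model.diff to_model.scale to_model_associator)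

lemma to_model_right_mults:
  "to_model (right_mults a bs) = right_mults (to_model a) (map to_model bs)"
  by (induction bs arbitrary: a) (simp_all add: right_mults_def to_model)

lemma right_mults_NPow:
  "right_mults (unit_vec (NPow x M)) (map (\<lambda>n. unit_vec (NLetter n)) ts)
     = unit_vec (NPow x (M + mset ts))"
  by (induction ts arbitrary: M) (simp_all add: right_mults_def unit_vec_mult)

lemma to_model_base_value:
  assumes "b \<in> base_syms"
  shows "to_model (base_value b) = (unit_vec (normal b) :: 'f::field model)"
proof (cases b)
  case (Base_v x ts)
  \<comment> \<open>After four letters only a single basis vector survives.\<close>
  then obtain s t u w r where ts: "ts = s # t # u # w # r"
    using assms by (auto simp: base_syms_def Suc_le_length_iff numeral_eq_Suc)
  have "right_mults (unit_vec (NLetter x)) (map (\<lambda>n. unit_vec (NLetter n)) ts)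
      = right_mults (unit_vec (NPow x {#s, t, u, w#})) (map (\<lambda>n. unit_vec (NLetter n) :: 'f model) r)"
    by (simp add: ts right_mults_def unit_vec_mult model.mult_linear NAss_Mul_annihilates
        sum_NAss_Mul_annihilates add_mset_commute)
  then show ?thesis
    by (simp add: Base_v to_model_right_mults to_model comp_def right_mults_NPow ts add_mset_commute)
qed (simp_all add: to_model to_model_associator to_model_h to_model.diff model.h_def associator_def
    unit_vec_mult model.mult_linear model_scale_2 NAss_Mul_annihilates add_mset_commute)

lemma unit_vec_eq_iff: "unit_vec s = (unit_vec r :: 'f::field model) \<longleftrightarrow> s = r"
proof
  assume "unit_vec s = (unit_vec r :: 'f model)"
  then have "coord s (unit_vec s :: 'f model) = coord s (unit_vec r :: 'f model)"
    by simp
  then show "s = r"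
    by (simp add: coord_unit_vec when_def split: if_splits)
qed simp

lemma normal_eq_if_base_value_eq:
  assumes "b \<in> base_syms" and "c \<in> base_syms"
    and "(base_value b :: 'f::field free_wn2) = base_value c"
  shows "normal b = normal c"
  using assms to_model_base_value[where 'f = 'f] by (metis unit_vec_eq_iff)

lemma base_value_eq_iff:
  assumes "b \<in> base_syms" and "c \<in> base_syms"
  shows "(base_value b :: 'f::field free_wn2) = base_value c \<longleftrightarrow> same_base b c"
  using assms normal_eq_if_base_value_eq same_base_if_normal_eq base_value_eq_if_same_base by blast

lemma independent_base_values:
  "free.independent (base_value ` base_syms :: 'f::field free_wn2 set)"
proof
  assume "free.dependent (base_value ` base_syms :: 'f free_wn2 set)"
  then obtain b where b: "b \<in> base_syms"
    and span: "(base_value b :: 'f free_wn2) \<in> free.span (base_value ` base_syms - {base_value b})"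
    unfolding free.dependent_def by blast
  \<comment> \<open>The coordinate of the image at \<open>normal b\<close> vanishes on all other base elements.\<close>
  from span have "coord (normal b) (to_model (base_value b :: 'f free_wn2)) = 0"
  proof (induction rule: free.span_induct_linear)
    case (base a)
    then obtain c where c: "c \<in> base_syms" "a = base_value c" and "base_value c \<noteq> (base_value b :: 'f free_wn2)"
      by blast
    then have "normal c \<noteq> normal b"
      using b base_value_eq_if_same_base same_base_if_normal_eq by blast
    with c show ?case
      by (simp add: to_model_base_value coord_unit_vec)
  qed (simp_all add: to_model.add to_model.scale)
  then show False
    using b by (simp add: to_model_base_value coord_unit_vec)
qed

lemma base_value_in_square:
  assumes "b \<in> base_syms" and "\<nexists>x. b = Letter x"
  shows "base_value b \<in> free.square"
  using assms by (cases b) (auto simp: base_syms_def intro!: free.right_mults_in_square)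

lemma unlisted_product_zero:
  assumes "b \<in> base_syms" and "c \<in> base_syms" and "\<not> listed_product b c"
  shows "base_value b * base_value c = (0 :: 'f::field free_wn2)"
proof (cases "(\<exists>x. b = Letter x) \<or> (\<exists>y. c = Letter y)")
  case True
  then show ?thesis
    using assms
    by (cases b; cases c)
      (auto simp: base_syms_def listed_product.simps free.mult_associator_product
        free.associator_product_mult free.mult_h free.mult_right_mults)
next
  case False
  then show ?thesis
    using assms by (intro free.square_mult_square base_value_in_square) auto
qed

lemma right_mults_snoc: "right_mults a (bs @ [b]) = right_mults a bs * b"
  by (simp add: right_mults_def)

lemma base_value_mult_in_span:
  assumes "b \<in> base_syms" and "c \<in> base_syms"
  shows "base_value b * base_value c \<in> free.span (base_value ` base_syms :: 'f::field free_wn2 set)"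
    (is "_ \<in> ?U")
proof (cases "listed_product b c")
  case False
  with assms show ?thesis
    by (simp add: unlisted_product_zero free.span_zero)
next
  case True
  have base: "base_value d \<in> ?U" if "d \<in> base_syms" for d
    using that by (simp add: free.span_base)
  have word: "gen x * gen y \<in> ?U" and left: "gen x * (gen y * gen z) \<in> ?U"
    and ass: "associator (gen x) (gen y) (gen z) \<in> ?U"
    and ass_mul: "associator (gen x) (gen y * gen z) (gen t) \<in> ?U"
    and h: "free.h (gen x) (gen y) (gen z) (gen t) \<in> ?U" for x y z t
    using base[of "Word2 x y"] base[of "Base_i x y z"] base[of "Base_ii x y z"]
      base[of "Base_iii x y z t"] base[of "Base_iv x y z t"]
    by (simp_all add: base_syms_def)
  have long: "right_mults (gen x) (map gen ts) \<in> ?U" if "length ts \<ge> 4" for x ts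
    using that base[of "Base_v x ts"] by (simp add: base_syms_def)
  note closed = free.span_add free.span_diff free.span_neg
  from True show ?thesis
  proof cases
    case (5 x z y)
    have "gen x * gen z * gen y
        = associator (gen x) (gen z) (gen y) + gen x * (gen z * gen y :: 'f free_wn2)"
      by (simp add: associator_def)
    then show ?thesis
      using 5 by (simp add: closed ass left)
  next
    case (8 x t1 t2 t3 y)
    have "right_mults (gen x) (map gen [t1, t2, t3, y]) \<in> ?U"
      by (rule long) simp
    then show ?thesis
      using 8 by (simp add: free.h_mult) (simp add: right_mults_def)
  next
    case (9 x ts y)
    then have "right_mults (gen x) (map gen (ts @ [y])) \<in> ?U"
      using assms by (intro long) (auto simp: base_syms_def)
    then show ?thesis
      using 9 by (simp add: right_mults_snoc)
  qed (simp_all add: word left closed ass_mul h free.left_mult_left_product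
      free.associator_mult_middle[symmetric] free.left_product_mult free.associator_mult
      commutator_def jordan_prod_def
      free.associator_diff free.associator_add)
qed

lemma span_base_values:
  "free.span (base_value ` base_syms) = (UNIV :: 'f::field free_wn2 set)" (is "?U = _")
proof -
  have mult: "a * b \<in> ?U" if "a \<in> ?U" and "b \<in> ?U" for a b
    using that(1)
  proof (induction rule: free.span_induct_linear)
    case (base a)
    show ?case
      using that(2)
      by (induction rule: free.span_induct_linear)
        (use base in \<open>auto simp: free.mult_linear free.span_zero
          intro: base_value_mult_in_span free.span_add free.span_scale\<close>)
  qed (auto simp: free.mult_linear free.span_zero intro: free.span_add free.span_scale)
  have "abs_free_wn2 s \<in> ?U" for s
  proof (induction s)
    case (Gen n)
    have "base_value (Letter n) \<in> ?U"
      by (intro free.span_base imageI) (simp add: base_syms_def)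
    then show ?case
      by (simp add: gen.abs_eq)
  next
    case Zero
    then show ?case
      using free.span_zero by (simp add: zero_free_wn2_def zero_aterm_def)
  next
    case (Add s t)
    then show ?case
      using free.span_add[OF Add] by (simp add: plus_free_wn2.abs_eq plus_aterm_def)
  next
    case (Neg s)
    then show ?case
      using free.span_neg[OF Neg] by (simp add: uminus_free_wn2.abs_eq uminus_aterm_def)
  next
    case (Scale r s)
    then show ?case
      using free.span_scale[OF Scale, of r] by (simp add: free_scale.abs_eq)
  next
    case (Mul s t)
    then show ?case
      using mult[OF Mul] by (simp add: times_free_wn2.abs_eq times_aterm_def)
  qed
  then have "a \<in> ?U" for a
    by (induction a) simp
  then show ?thesis
    by blast
qed

theorem theorem2:
  fixes X :: "nat \<Rightarrow> 'f::field free_wn2"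
    and val :: "base_sym \<Rightarrow> 'f free_wn2"
  defines "X \<equiv> gen"
    and "val \<equiv> base_value"
  assumes char: "CHAR('f) \<noteq> 2"
  shows
    \<comment> \<open>linear base\<close>
    "(\<forall>b\<in>base_syms. \<forall>c\<in>base_syms. val b = val c \<longleftrightarrow> same_base b c)
     \<and> free.independent (val ` base_syms)
     \<and> free.span (val ` base_syms) = UNIV
     \<comment> \<open>rule (1)\<close>
     \<and> (\<forall>x y. X x * X y = val (Word2 x y))
     \<and> (\<forall>x y z. X x * (X y * X z) = val (Base_i x y z))
     \<and> (\<forall>x y z t. X x * (X y * (X z * X t)) = - associator (X x) (X z * X y) (X t))
     \<and> (\<forall>x y t1 t2. X x * associator (X y) (X t1) (X t2) = associator (X y) (X x * X t1) (X t2))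
     \<comment> \<open>rule (2)\<close>
     \<and> (\<forall>x z y. (X x * X z) * X y = associator (X x) (X z) (X y) + X x * (X z * X y))
     \<and> (\<forall>x z t y. (X x * (X z * X t)) * X y
          = associator (X x) (commutator (X z) (X t)) (X y) + associator (X z) (X x * X t) (X y))
     \<and> (\<forall>x t1 t2 y. associator (X x) (X t1) (X t2) * X y
          = free.h (X x) (X t1) (X t2) (X y) + associator (X x) (jordan_prod (X t1) (X t2)) (X y))
     \<and> (\<forall>x t1 t2 t3 y. free.h (X x) (X t1) (X t2) (X t3) * X y
          = right_mults (X x * X t1) [X t2, X t3, X y])
     \<and> (\<forall>x ts y. length ts \<ge> 4 \<longrightarrow>
          right_mults (X x) (map X ts) * X y = right_mults (X x) (map X ts @ [X y]))
     \<comment> \<open>rule (3)\<close>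
     \<and> (\<forall>b\<in>base_syms. \<forall>c\<in>base_syms. \<not> listed_product b c \<longrightarrow> val b * val c = 0)"
  unfolding X_def val_def
  by (intro conjI ballI allI impI base_value_eq_iff independent_base_values span_base_values
      free.left_mult_left_product free.left_product_mult free.associator_mult free.h_mult
      unlisted_product_zero)
    (simp_all add: free.associator_mult_middle associator_def[of "gen _" "gen _" "gen _"]
      right_mults_snoc)

end
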